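(* Every pointed group-rack can be embedded into an averaging group. That is, for every pointed group-rack $(G,\cdot,\star)$ there exist an averaging group $(H,\mathcal{A})$ and an injective map $i:G\rightarrow H$ that is a morphism of group-racks from $(G,\cdot,\star)$ to $(H,\cdot,\diamond_{\mathcal{A}})$, where $g\diamond_{\mathcal{A}}h = \mathcal{A}(g)h\mathcal{A}(g)^{-1}$ for $g,h\in H$.
   Context: A (left) rack $(Q,\diamond)$ is a nonempty set $Q$ with a binary operation $\diamond$ such that $x\diamond(y\diamond z) = (x\diamond y)\diamond(x\diamond z)$ for all $x,y,z$, and for any $x,y$ there is a unique $c$ with $x\diamond c = y$. A group-rack is a triple $(G,\cdot,\star)$ in which $(G,\cdot)$ is a group, $(G,\star)$ is a rack, and $x\star(yz) = (x\star y)(x\star z)$ for all $x,y,z\in G$. It is pointed if, with $e$ the identity element of the group, $x\star e=e$ and $e\star x=x$ for all $x\in G$. A morphism of group-racks is a map that is both a group homomorphism and a rack homomorphism (i.e. preserves both binary operations). An averaging group is a pair $(H,\mathcal{A})$ of a group $H$ and a map $\mathcal{A}:H\to H$ with $\mathcal{A}(g)\mathcal{A}(h)\mathcal{A}(g)^{-1} = \mathcal{A}(\mathcal{A}(g)h\mathcal{A}(g)^{-1})$ for all $g,h\in H$; the triple $(H,\cdot,\diamond_{\mathcal{A}})$ is then a group-rack, called the group-rack induced by $\mathcal{A}$. *)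

theory Defs
  imports "HOL-Algebra.Group"
begin

locale rack =
  fixes Q :: "'a set"
    and op :: "'a \<Rightarrow> 'a \<Rightarrow> 'a"  (infixl \<open>\<diamondop>\<close> 70)
  assumes nonempty: "Q \<noteq> {}"
    and op_closed: "\<lbrakk>x \<in> Q; y \<in> Q\<rbrakk> \<Longrightarrow> x \<diamondop> y \<in> Q"
    and self_distrib: "\<lbrakk>x \<in> Q; y \<in> Q; z \<in> Q\<rbrakk> \<Longrightarrow> x \<diamondop> (y \<diamondop> z) = (x \<diamondop> y) \<diamondop> (x \<diamondop> z)"
    and left_divisible: "\<lbrakk>x \<in> Q; y \<in> Q\<rbrakk> \<Longrightarrow> \<exists>!c. c \<in> Q \<and> x \<diamondop> c = y"

definition rack_hom :: "'a set \<Rightarrow> ('a \<Rightarrow> 'a \<Rightarrow> 'a) \<Rightarrow> 'b set \<Rightarrow> ('b \<Rightarrow> 'b \<Rightarrow> 'b) \<Rightarrow> ('a \<Rightarrow> 'b) set"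
  where "rack_hom Q op R op' =
    {f. f \<in> Q \<rightarrow> R \<and> (\<forall>x\<in>Q. \<forall>y\<in>Q. f (op x y) = op' (f x) (f y))}"

locale group_rack = group G + rack "carrier G" star
  for G (structure) and star (infixl \<open>\<star>\<close> 70) +
  assumes star_mult_distrib:
    "\<lbrakk>x \<in> carrier G; y \<in> carrier G; z \<in> carrier G\<rbrakk> \<Longrightarrow> x \<star> (y \<otimes> z) = (x \<star> y) \<otimes> (x \<star> z)"

locale pointed_group_rack = group_rack +
  assumes star_one: "x \<in> carrier G \<Longrightarrow> x \<star> \<one> = \<one>"
    and one_star: "x \<in> carrier G \<Longrightarrow> \<one> \<star> x = x"

locale group_rack_morphism =
  dom: group_rack G star + cod: group_rack H star'
  for G :: "('a, 'm) monoid_scheme" and star :: "'a \<Rightarrow> 'a \<Rightarrow> 'a"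
    and H :: "('b, 'n) monoid_scheme" and star' :: "'b \<Rightarrow> 'b \<Rightarrow> 'b" +
  fixes f :: "'a \<Rightarrow> 'b"
  assumes morphism_group: "f \<in> hom G H"
    and morphism_rack: "f \<in> rack_hom (carrier G) star (carrier H) star'"

locale averaging_group = group H
  for H (structure) +
  fixes A :: "'a \<Rightarrow> 'a"
  assumes A_closed: "g \<in> carrier H \<Longrightarrow> A g \<in> carrier H"
    and averaging: "\<lbrakk>g \<in> carrier H; h \<in> carrier H\<rbrakk> \<Longrightarrow>
      A g \<otimes> A h \<otimes> inv (A g) = A (A g \<otimes> h \<otimes> inv (A g))"

definition induced_op :: "('a, 'm) monoid_scheme \<Rightarrow> ('a \<Rightarrow> 'a) \<Rightarrow> 'a \<Rightarrow> 'a \<Rightarrow> 'a"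
  where "induced_op H A g h = A g \<otimes>\<^bsub>H\<^esub> h \<otimes>\<^bsub>H\<^esub> inv\<^bsub>H\<^esub> (A g)"

lemma (in averaging_group) group_rack_induced_op: "group_rack H (induced_op H A)"
proof unfold_locales
  have conj_conj: "a \<otimes> (b \<otimes> z \<otimes> inv b) \<otimes> inv a = (a \<otimes> b) \<otimes> z \<otimes> inv (a \<otimes> b)"
    if "a \<in> carrier H" "b \<in> carrier H" "z \<in> carrier H" for a b z
    using that by (simp add: inv_mult_group m_assoc)
  show "carrier H \<noteq> {}"
    using one_closed by blast
  show "induced_op H A x y \<in> carrier H" if "x \<in> carrier H" "y \<in> carrier H" for x y
    using that by (simp add: induced_op_def A_closed)
  show "induced_op H A x (induced_op H A y z) =
      induced_op H A (induced_op H A x y) (induced_op H A x z)"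
    if "x \<in> carrier H" "y \<in> carrier H" "z \<in> carrier H" for x y z
    using that by (simp add: induced_op_def A_closed averaging [symmetric] conj_conj)
      (simp add: A_closed m_assoc inv_mult_group inv_solve_left)
  show "\<exists>!c. c \<in> carrier H \<and> induced_op H A x c = y"
    if "x \<in> carrier H" "y \<in> carrier H" for x y
  proof (rule ex1I [of _ "inv (A x) \<otimes> y \<otimes> A x"])
    show "inv (A x) \<otimes> y \<otimes> A x \<in> carrier H \<and> induced_op H A x (inv (A x) \<otimes> y \<otimes> A x) = y"
      using that A_closed conj_conj [of "A x" "inv (A x)" y] by (simp add: induced_op_def)
    show "c = inv (A x) \<otimes> y \<otimes> A x" if "c \<in> carrier H \<and> induced_op H A x c = y" for c
      using that \<open>x \<in> carrier H\<close> A_closed conj_conj [of "inv (A x)" "A x" c]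
      by (auto simp add: induced_op_def)
  qed
  show "induced_op H A x (y \<otimes> z) = induced_op H A x y \<otimes> induced_op H A x z"
    if "x \<in> carrier H" "y \<in> carrier H" "z \<in> carrier H" for x y z
    using that by (simp add: induced_op_def A_closed m_assoc)
      (simp add: A_closed m_assoc [symmetric])
qed

end

theory Submission
  imports Defs "HOL-Algebra.Bij"
begin

text \<open>
  In the holomorph of \<open>G\<close>, the semidirect product of \<open>G\<close> with its automorphism group, conjugation
  by \<open>(\<one>, \<alpha>)\<close> acts on the factor \<open>G\<close> as \<open>\<alpha>\<close>.  Left translations \<open>L x = (x \<star> _)\<close> of a group-rack
  are automorphisms, and self-distributivity reads \<open>L (x \<star> y) = L x \<circ> L y \<circ> (L x)\<inverse>\<close>.  Hence
  \<open>(x, \<phi>) \<mapsto> (\<one>, L x)\<close> is an averaging operator, and \<open>x \<mapsto> (x, id)\<close> is the desired embedding.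
\<close>

text \<open>Elements of \<open>auto G\<close> are extensional on \<open>carrier G\<close>, so
  composition and identity in the second factor are restricted to the carrier.\<close>

definition holomorph :: "('a, 'm) monoid_scheme \<Rightarrow> ('a \<times> ('a \<Rightarrow> 'a)) monoid"
  where "holomorph G =
    \<lparr>carrier = carrier G \<times> auto G,
     mult = (\<lambda>(x, \<alpha>) (y, \<beta>). (x \<otimes>\<^bsub>G\<^esub> \<alpha> y, compose (carrier G) \<alpha> \<beta>)),
     one = (\<one>\<^bsub>G\<^esub>, \<lambda>x\<in>carrier G. x)\<rparr>"

context group
begin

lemma carrier_AutoGroup [simp]: "carrier (AutoGroup G) = auto G"
  by (simp add: AutoGroup_def)

lemma one_AutoGroup: "\<one>\<^bsub>AutoGroup G\<^esub> = (\<lambda>x\<in>carrier G. x)"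
  by (simp add: AutoGroup_def BijGroup_def)

lemma mult_AutoGroup:
  "\<alpha> \<in> auto G \<Longrightarrow> \<beta> \<in> auto G \<Longrightarrow> \<alpha> \<otimes>\<^bsub>AutoGroup G\<^esub> \<beta> = compose (carrier G) \<alpha> \<beta>"
  by (simp add: AutoGroup_def BijGroup_def auto_def)

lemma auto_closed [simp]: "\<alpha> \<in> auto G \<Longrightarrow> x \<in> carrier G \<Longrightarrow> \<alpha> x \<in> carrier G"
  unfolding auto_def by (blast intro: hom_in_carrier)

lemma auto_mult: "\<alpha> \<in> auto G \<Longrightarrow> x \<in> carrier G \<Longrightarrow> y \<in> carrier G \<Longrightarrow> \<alpha> (x \<otimes> y) = \<alpha> x \<otimes> \<alpha> y"
  unfolding auto_def by (blast intro: hom_mult)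

lemma auto_one [simp]: "\<alpha> \<in> auto G \<Longrightarrow> \<alpha> \<one> = \<one>"
  using hom_one [OF _ is_group is_group] by (auto simp: auto_def)

lemma carrier_holomorph: "carrier (holomorph G) = carrier G \<times> carrier (AutoGroup G)"
  by (simp add: holomorph_def)

lemma one_holomorph: "\<one>\<^bsub>holomorph G\<^esub> = (\<one>, \<one>\<^bsub>AutoGroup G\<^esub>)"
  by (simp add: holomorph_def one_AutoGroup)

text \<open>Expressing the second coordinate through \<open>AutoGroup G\<close> makes the group laws
  of automorphisms available there.\<close>

lemma mult_holomorph:
  assumes "\<alpha> \<in> auto G" "\<beta> \<in> auto G"
  shows "(x, \<alpha>) \<otimes>\<^bsub>holomorph G\<^esub> (y, \<beta>) = (x \<otimes> \<alpha> y, \<alpha> \<otimes>\<^bsub>AutoGroup G\<^esub> \<beta>)"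
  using assms by (simp add: holomorph_def mult_AutoGroup)

lemma group_holomorph: "group (holomorph G)"
proof -
  interpret Aut: group "AutoGroup G"
    by (rule AutoGroup)
  have mult_closed: "\<alpha> \<otimes>\<^bsub>AutoGroup G\<^esub> \<beta> \<in> auto G" if "\<alpha> \<in> auto G" "\<beta> \<in> auto G" for \<alpha> \<beta>
    using that Aut.m_closed by simp
  have one_auto: "\<one>\<^bsub>AutoGroup G\<^esub> \<in> auto G"
    using Aut.one_closed by simp
  show ?thesis
  proof (rule groupI)
    fix p assume "p \<in> carrier (holomorph G)"
    then obtain x \<alpha> where p: "p = (x, \<alpha>)" "x \<in> carrier G" "\<alpha> \<in> auto G"
      by (auto simp: carrier_holomorph)
    define \<beta> where "\<beta> = inv\<^bsub>AutoGroup G\<^esub> \<alpha>"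
    have \<beta>: "\<beta> \<in> auto G" "\<beta> \<otimes>\<^bsub>AutoGroup G\<^esub> \<alpha> = \<one>\<^bsub>AutoGroup G\<^esub>"
      using p Aut.inv_closed by (simp_all add: \<beta>_def)
    show "\<one>\<^bsub>holomorph G\<^esub> \<otimes>\<^bsub>holomorph G\<^esub> p = p"
      using p one_auto by (simp add: one_holomorph mult_holomorph) (simp add: one_AutoGroup)
    \<comment> \<open>With \<beta> the inverse of \<alpha>, the first coordinate of
      \<open>(u, \<beta>)\<close> times \<open>(x, \<alpha>)\<close> is
      \<open>u \<otimes> \<beta> x\<close>, which forces \<open>u = inv (\<beta> x)\<close>.\<close>
    show "\<exists>q\<in>carrier (holomorph G). q \<otimes>\<^bsub>holomorph G\<^esub> p = \<one>\<^bsub>holomorph G\<^esub>"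
      using p \<beta> by (intro bexI [of _ "(inv (\<beta> x), \<beta>)"])
        (simp_all add: carrier_holomorph one_holomorph mult_holomorph)
  \<comment> \<open>Closure and associativity remain. Associativity uses that automorphisms are
    multiplicative and that a product of automorphisms acts as their composite.\<close>
  qed (auto simp: carrier_holomorph one_holomorph mult_holomorph mult_closed one_auto
        Aut.m_assoc auto_mult m_assoc, simp add: mult_AutoGroup compose_eq)
qed

lemma conj_holomorph:
  assumes "\<alpha> \<in> auto G" "\<beta> \<in> auto G" "y \<in> carrier G"
  shows "(\<one>, \<alpha>) \<otimes>\<^bsub>holomorph G\<^esub> (y, \<beta>) \<otimes>\<^bsub>holomorph G\<^esub> inv\<^bsub>holomorph G\<^esub> (\<one>, \<alpha>) =
    (\<alpha> y, \<alpha> \<otimes>\<^bsub>AutoGroup G\<^esub> \<beta> \<otimes>\<^bsub>AutoGroup G\<^esub> inv\<^bsub>AutoGroup G\<^esub> \<alpha>)"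
proof -
  interpret Aut: group "AutoGroup G"
    by (rule AutoGroup)
  interpret Hol: group "holomorph G"
    by (rule group_holomorph)
  define \<gamma> where "\<gamma> = \<alpha> \<otimes>\<^bsub>AutoGroup G\<^esub> \<beta> \<otimes>\<^bsub>AutoGroup G\<^esub> inv\<^bsub>AutoGroup G\<^esub> \<alpha>"
  have \<gamma>: "\<gamma> \<in> auto G" "\<gamma> \<otimes>\<^bsub>AutoGroup G\<^esub> \<alpha> = \<alpha> \<otimes>\<^bsub>AutoGroup G\<^esub> \<beta>"
    using assms Aut.m_closed Aut.inv_closed by (simp_all add: \<gamma>_def Aut.m_assoc)
  have carr: "(\<one>, \<alpha>) \<in> carrier (holomorph G)" "(y, \<beta>) \<in> carrier (holomorph G)"
    "(\<alpha> y, \<gamma>) \<in> carrier (holomorph G)"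
    using assms \<gamma> by (auto simp: carrier_holomorph)
  \<comment> \<open>Multiplying the claim by \<open>(\<one>, \<alpha>)\<close> on the right avoids
    computing an inverse in the holomorph. The first coordinates agree because \<gamma> fixes
    \<one>.\<close>
  have "(\<one>, \<alpha>) \<otimes>\<^bsub>holomorph G\<^esub> (y, \<beta>) = (\<alpha> y, \<gamma>) \<otimes>\<^bsub>holomorph G\<^esub> (\<one>, \<alpha>)"
    using assms \<gamma> by (simp add: mult_holomorph)
  then have "(\<one>, \<alpha>) \<otimes>\<^bsub>holomorph G\<^esub> (y, \<beta>) \<otimes>\<^bsub>holomorph G\<^esub> inv\<^bsub>holomorph G\<^esub> (\<one>, \<alpha>) = (\<alpha> y, \<gamma>)"
    using carr by (simp add: Hol.inv_solve_right')
  then show ?thesis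
    by (simp add: \<gamma>_def)
qed

end

context group_rack
begin

definition left_translation :: "'a \<Rightarrow> 'a \<Rightarrow> 'a"
  where "left_translation x = (\<lambda>y\<in>carrier G. x \<star> y)"

text \<open>Unique left division gives bijectivity; distributivity of \<star> over the product gives
  the homomorphism property.\<close>

lemma left_translation_auto:
  assumes "x \<in> carrier G"
  shows "left_translation x \<in> auto G"
proof -
  have "bij_betw (left_translation x) (carrier G) (carrier G)"
    unfolding bij_betw_def
  proof
    show "inj_on (left_translation x) (carrier G)"
    proof (rule inj_onI)
      fix y z
      assume "y \<in> carrier G" "z \<in> carrier G" "left_translation x y = left_translation x z"
      then show "y = z"
        \<comment> \<open>Both y and z solve \<open>x \<star> c = x \<star> z\<close>, whose
          solution is unique.\<close>
        using left_divisible [of x "x \<star> z"] op_closed assms by (auto simp: left_translation_def)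
    qed
    show "left_translation x ` carrier G = carrier G"
    proof
      show "left_translation x ` carrier G \<subseteq> carrier G"
        using assms op_closed by (auto simp: left_translation_def)
      show "carrier G \<subseteq> left_translation x ` carrier G"
      proof
        fix y assume "y \<in> carrier G"
        then obtain c where "c \<in> carrier G" "x \<star> c = y"
          using left_divisible [OF assms] by blast
        then show "y \<in> left_translation x ` carrier G"
          by (auto simp: left_translation_def)
      qed
    qed
  qed
  then have "left_translation x \<in> Bij (carrier G)"
    by (simp add: Bij_def left_translation_def)
  moreover have "left_translation x \<in> hom G G"
    by (rule homI) (simp_all add: left_translation_def assms op_closed star_mult_distrib)
  ultimately show ?thesis
    by (simp add: auto_def)
qed

text \<open>Evaluated pointwise, self-distributivity says that L x after L y equals L (x \<star> y)
  after L x; cancelling L x on the right turns this into a conjugation.\<close>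

lemma conj_left_translation:
  assumes "x \<in> carrier G" "y \<in> carrier G"
  shows "left_translation x \<otimes>\<^bsub>AutoGroup G\<^esub> left_translation y \<otimes>\<^bsub>AutoGroup G\<^esub>
    inv\<^bsub>AutoGroup G\<^esub> left_translation x = left_translation (x \<star> y)"
proof -
  interpret Aut: group "AutoGroup G"
    by (rule AutoGroup)
  have L: "left_translation x \<in> auto G" "left_translation y \<in> auto G"
    "left_translation (x \<star> y) \<in> auto G"
    using assms left_translation_auto op_closed by blast+
  have "compose (carrier G) (left_translation x) (left_translation y) =
      compose (carrier G) (left_translation (x \<star> y)) (left_translation x)"
    unfolding compose_def left_translation_def
    by (rule restrict_ext) (simp add: assms op_closed self_distrib [OF assms])
  then have "left_translation x \<otimes>\<^bsub>AutoGroup G\<^esub> left_translation y =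
      left_translation (x \<star> y) \<otimes>\<^bsub>AutoGroup G\<^esub> left_translation x"
    by (simp add: mult_AutoGroup L)
  then show ?thesis
    using L by (subst Aut.inv_solve_right') (simp_all add: Aut.m_closed [simplified])
qed

definition holomorph_averaging :: "'a \<times> ('a \<Rightarrow> 'a) \<Rightarrow> 'a \<times> ('a \<Rightarrow> 'a)"
  where "holomorph_averaging p = (\<one>, left_translation (fst p))"

text \<open>For p = (x, \<alpha>) and q = (y, \<beta>), conjugating the value at q by the value at p
  gives (\<one>, L (x \<star> y)), since L x fixes \<one>. Conjugating q itself gives first
  coordinate x \<star> y, and the operator reads only that coordinate, so both sides agree.\<close>

lemma averaging_group_holomorph: "averaging_group (holomorph G) holomorph_averaging"
proof -
  interpret Hol: group "holomorph G"
    by (rule group_holomorph)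
  show ?thesis
    by unfold_locales
      (auto simp: holomorph_averaging_def carrier_holomorph left_translation_auto
        conj_holomorph conj_left_translation, simp add: left_translation_def)
qed

text \<open>The identity automorphism makes the twist in the product trivial, and it is fixed under
  conjugation by L x. Hence the induced operation sends (x, id) and (y, id) to (L x y, id) = (x
  \<star> y, id).\<close>

lemma group_rack_morphism_holomorph:
  "group_rack_morphism G star (holomorph G) (induced_op (holomorph G) holomorph_averaging)
    (\<lambda>x. (x, \<one>\<^bsub>AutoGroup G\<^esub>))"
proof -
  interpret Aut: group "AutoGroup G"
    by (rule AutoGroup)
  interpret ind: group_rack "holomorph G" "induced_op (holomorph G) holomorph_averaging"
    by (rule averaging_group.group_rack_induced_op [OF averaging_group_holomorph])
  have one_auto: "\<one>\<^bsub>AutoGroup G\<^esub> \<in> auto G"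
    using Aut.one_closed by simp
  have "(\<lambda>x. (x, \<one>\<^bsub>AutoGroup G\<^esub>)) \<in> hom G (holomorph G)"
    using one_auto
    by (auto simp: hom_def carrier_holomorph mult_holomorph) (simp add: one_AutoGroup)
  moreover have "(\<lambda>x. (x, \<one>\<^bsub>AutoGroup G\<^esub>)) \<in>
      rack_hom (carrier G) star (carrier (holomorph G))
        (induced_op (holomorph G) holomorph_averaging)"
    using one_auto left_translation_auto
    by (auto simp: rack_hom_def carrier_holomorph induced_op_def holomorph_averaging_def
        conj_holomorph) (simp add: left_translation_def)
  ultimately show ?thesis
    by unfold_locales
qed

end

theorem theorem2p20:
  fixes G :: "('a, 'm) monoid_scheme" and star :: "'a \<Rightarrow> 'a \<Rightarrow> 'a"
  assumes "pointed_group_rack G star"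
  shows "\<exists>(H :: ('a \<times> ('a \<Rightarrow> 'a)) monoid) A i.
    averaging_group H A \<and>
    group_rack_morphism G star H (induced_op H A) i \<and>
    inj_on i (carrier G)"
proof -
  interpret pointed_group_rack G star
    by (rule assms)
  have "inj_on (\<lambda>x. (x, \<one>\<^bsub>AutoGroup G\<^esub>)) (carrier G)"
    by (simp add: inj_on_def)
  then show ?thesis
    using averaging_group_holomorph group_rack_morphism_holomorph by blast
qed

end
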